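(* Let $\mathbb B=\{0,1\}$ be the idempotent semifield ($1+1=1$) and let $\mathbf S$ be the hyperfield of signs. Let $E,F$ be semimodules over $\mathbb B$ with $\underline{\mathrm{rk}}\,E=\underline{\mathrm{rk}}\,F=1$. (i) $E\otimes_{\mathbb B}\mathbf S$ is a canonical hypergroup and a module over $\mathbf S$ in the following sense: $$\lambda(v\smile v')=\lambda v\smile\lambda v',\qquad(\lambda+\lambda')v\subset\lambda v\smile\lambda'v\qquad\forall\lambda,\lambda'\in\mathbf S,\ \forall v,v'\in E\otimes_{\mathbb B}\mathbf S.$$ (ii) Let $f:E\to F$ be a morphism of $\mathbb B$-semimodules. Then the formula $(f\otimes_{\mathbb B}\mathrm{id}_{\mathbf S})(\pm x):=\pm f(x)$, $x\in E$, defines a morphism of $\mathbf S$-modules $f\otimes_{\mathbb B}\mathrm{id}_{\mathbf S}:E\otimes_{\mathbb B}\mathbf S\to F\otimes_{\mathbb B}\mathbf S$. (iii) Let $\epsilon:E\setminus\{0\}\to\{\pm1\}$ be a map of sets. Then $\tilde\epsilon(\pm x):=\pm\epsilon(x)x$, $x\in E$ (with $\tilde\epsilon(0)=0$), defines an automorphism $\tilde\epsilon$ of $E\otimes_{\mathbb B}\mathbf S$ as a module over $\mathbf S$. (iv) Let $g\in\mathrm{Hom}_{\mathbf S}(E\otimes_{\mathbb B}\mathbf S,F\otimes_{\mathbb B}\mathbf S)$ be a morphism of $\mathbf S$-modules such that $g^{-1}(\{0\})=\{0\}$. Then there exists a unique pair $(f,\epsilon)$ of a morphism of $\mathbb B$-semimodules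 $f:E\to F$ and a map of sets $\epsilon:E\setminus\{0\}\to\{\pm1\}$ such that $g=(f\otimes_{\mathbb B}\mathrm{id}_{\mathbf S})\circ\tilde\epsilon$.
   Context: A semimodule over $\mathbb B$ is a commutative monoid $(E,\vee)$ with identity $0$ and $x\vee x=x$ for all $x$. Its free rank $\underline{\mathrm{rk}}\,E$ is the largest $n$ such that $E$ contains a subsemimodule isomorphic to $\mathbb B^n$; when $\underline{\mathrm{rk}}\,E=1$ the relation $x\le y\iff x\vee y=y$ is a total order on $E$ with smallest element $0$. $\mathbf S=\{-1,0,1\}$ is the hyperfield of signs: usual multiplication, and hyperaddition $0+x=x$, $1+1=1$, $(-1)+(-1)=-1$, $1+(-1)=\{-1,0,1\}$. $E\otimes_{\mathbb B}\mathbf S$ is the quotient of $E\times\{\pm1\}$ by the identification $(0,-1)\sim(0,1)$; elements are written $\pm x$, $x\in E$, with $|\pm x|:=x\in E$, and $\mathbf S$ acts by multiplication of signs and $0\cdot v=0$. It has the multivalued operation: $x\smile y=x$ if $|x|>|y|$ or $x=y$; $x\smile y=y$ if $|x|<|y|$ or $x=y$; $x\smile y=[-x,x]:=\{z\mid|z|\le|x|\}$ if $y=-x$. A canonical hypergroup is a set $H$ with a multivalued operation $+$ (taking non-empty subsets as values) and an element $0$ such that: $x+y=y+x$; $(x+y)+z=x+(y+z)$; $0+x=x=x+0$; for each $x$ there is a unique $y=:-x$ with $0\in x+y$; $x\in y+z$ implies $z\in x-y$. A morphism $g$ of $\mathbf S$-modules is a map with $g(\lambda x)=\lambda g(x)$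 for $\lambda\in\mathbf S$ and $g(x\smile y)\subset g(x)\smile g(y)$ for all $x,y$. An automorphism is a bijective map $g$ with $g(\lambda x)=\lambda g(x)$ and $g(x\smile y)=g(x)\smile g(y)$. *)

theory Defs
  imports Main "HOL-Library.FuncSet" "HOL-Library.Extended_Nat"
begin

unbundle lattice_syntax

section \<open>Semimodules over the Boolean semifield\<close>

text \<open>
  A semimodule over \<open>\<bool> = {0,1}\<close> is a commutative idempotent monoid \<open>(E, \<or>, 0)\<close>.  The class
  \<^class>\<open>bounded_semilattice_sup_bot\<close> is used for this, with \<open>\<squnion>\<close> for \<open>\<or>\<close>, \<open>\<bottom>\<close> for \<open>0\<close>, and with
  \<open>x \<le> y\<close> equivalent to \<open>x \<squnion> y = y\<close>.  The next two facts show that this is the same as a commutative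
  idempotent monoid: the order is no additional datum.
\<close>

lemma semilattice_neutr_sup_bot:
  "semilattice_neutr (\<squnion>) (\<bottom> :: 'a::bounded_semilattice_sup_bot)"
  by unfold_locales

lemma bounded_semilattice_sup_bot_of_semilattice_neutr:
  assumes "semilattice_neutr f z"
  shows "class.bounded_semilattice_sup_bot f
           (\<lambda>x y. f x y = y) (\<lambda>x y. f x y = y \<and> x \<noteq> y) z"
proof -
  interpret semilattice_neutr f z by fact
  show ?thesis
    by unfold_locales (auto simp: ac_simps, (metis assoc commute left_idem)+)
qed

definition B_hom ::
  "('a::bounded_semilattice_sup_bot \<Rightarrow> 'b::bounded_semilattice_sup_bot) \<Rightarrow> bool" where
  "B_hom f \<longleftrightarrow> f \<bottom> = \<bottom> \<and> (\<forall>x y. f (x \<squnion> y) = f x \<squnion> f y)"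

definition subsemimodule :: "'a::bounded_semilattice_sup_bot set \<Rightarrow> bool" where
  "subsemimodule A \<longleftrightarrow> \<bottom> \<in> A \<and> (\<forall>x\<in>A. \<forall>y\<in>A. x \<squnion> y \<in> A)"

text \<open>
  \<open>\<bool>\<close> is the type \<^typ>\<open>bool\<close>; a vector of \<open>\<bool>\<^sup>n\<close> is a sequence supported on the indices \<open>i < n\<close>,
  with componentwise \<open>\<squnion>\<close>.
\<close>

definition B_power :: "nat \<Rightarrow> (nat \<Rightarrow> bool) set" where
  "B_power n = {v. \<forall>i\<ge>n. \<not> v i}"

definition iso_B_power :: "nat \<Rightarrow> 'a::bounded_semilattice_sup_bot set \<Rightarrow> bool" where
  "iso_B_power n A \<longleftrightarrow>
     (\<exists>\<phi>. bij_betw \<phi> (B_power n) A \<and> \<phi> \<bottom> = \<bottom> \<and>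
          (\<forall>u\<in>B_power n. \<forall>v\<in>B_power n. \<phi> (u \<squnion> v) = \<phi> u \<squnion> \<phi> v))"

text \<open>The value is \<open>\<infinity>\<close> if \<open>E\<close> contains copies of \<open>\<bool>\<^sup>n\<close> for arbitrarily large \<open>n\<close>.\<close>

definition free_rank :: "'a::bounded_semilattice_sup_bot itself \<Rightarrow> enat" where
  "free_rank _ = (SUP n \<in> {n. \<exists>A :: 'a set. subsemimodule A \<and> iso_B_power n A}. enat n)"

section \<open>The hyperfield of signs\<close>

typedef signs = "{-1, 0, 1 :: int}"
  by auto

setup_lifting type_definition_signs

instantiation signs :: "{zero, one, uminus, times}"
begin

lift_definition zero_signs :: signs is 0 by simp
lift_definition one_signs :: signs is 1 by simp
lift_definition uminus_signs :: "signs \<Rightarrow> signs" is uminus by auto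
lift_definition times_signs :: "signs \<Rightarrow> signs \<Rightarrow> signs" is times by auto

instance ..

end

lemma signs_one_neq_zero: "(1 :: signs) \<noteq> 0" "(0 :: signs) \<noteq> 1"
  by (transfer; simp)+

lemma signs_nonzero_iff: "s \<in> {-1, 1} \<longleftrightarrow> (s :: signs) \<noteq> 0"
  by transfer auto

lemma signs_mult_eq_zero_iff: "a * b = 0 \<longleftrightarrow> a = 0 \<or> b = (0 :: signs)"
  by transfer auto

lemma signs_cases: "s = -1 \<or> s = 0 \<or> s = (1 :: signs)"
  by transfer auto

text \<open>Otherwise the lifting of operations to the next type would go down to \<^typ>\<open>int\<close>.\<close>

lifting_forget signs.lifting

definition signs_hyperadd :: "signs \<Rightarrow> signs \<Rightarrow> signs set" where
  "signs_hyperadd a b =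
     (if a = 0 then {b} else if b = 0 then {a} else if a = b then {a} else {-1, 0, 1})"

section \<open>The extension of scalars of a semimodule from \<open>\<bool>\<close> to the signs\<close>

definition tensor_S_rel ::
  "'a::bounded_semilattice_sup_bot \<times> signs \<Rightarrow> 'a \<times> signs \<Rightarrow> bool" where
  "tensor_S_rel p q \<longleftrightarrow>
     p \<in> UNIV \<times> {-1, 1} \<and> q \<in> UNIV \<times> {-1, 1} \<and> (p = q \<or> fst p = \<bottom> \<and> fst q = \<bottom>)"

text \<open>The quotient of \<open>E \<times> {\<plusminus>1}\<close> (not of all of \<open>E \<times> {-1, 0, 1}\<close>), hence a partial quotient.\<close>

quotient_type (overloaded) 'a tensor_S = "'a::bounded_semilattice_sup_bot \<times> signs" / partial: tensor_S_rel
proof (rule part_equivpI)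
  show "\<exists>p :: 'a \<times> signs. tensor_S_rel p p"
    by (rule exI[of _ "(\<bottom>, 1)"]) (simp add: tensor_S_rel_def)
  show "symp (tensor_S_rel :: 'a \<times> signs \<Rightarrow> _)"
    by (auto simp: symp_def tensor_S_rel_def)
  show "transp (tensor_S_rel :: 'a \<times> signs \<Rightarrow> _)"
    by (auto simp: transp_def tensor_S_rel_def)
qed

text \<open>\<open>signed 1 x\<close> and \<open>signed (-1) x\<close> are \<open>+x\<close> and \<open>-x\<close>; for convenience \<open>signed 0 x\<close> is \<open>0\<close>.\<close>

lift_definition signed ::
  "signs \<Rightarrow> 'a::bounded_semilattice_sup_bot \<Rightarrow> 'a tensor_S"
  is "\<lambda>s x. if s = 0 then (\<bottom>, 1) else (x, s)"
  unfolding tensor_S_rel_def using signs_nonzero_iff by (auto split: if_splits)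

lift_definition modulus :: "'a::bounded_semilattice_sup_bot tensor_S \<Rightarrow> 'a" is fst
  by (auto simp: tensor_S_rel_def)

lift_definition act ::
  "signs \<Rightarrow> 'a::bounded_semilattice_sup_bot tensor_S \<Rightarrow> 'a tensor_S"  (infixr "\<cdot>" 75)
  is "\<lambda>l (x, s). if l = 0 then (\<bottom>, 1) else (x, l * s)"
  unfolding tensor_S_rel_def mem_Times_iff signs_nonzero_iff
  by (auto simp: signs_mult_eq_zero_iff signs_one_neq_zero split: if_splits)

instantiation tensor_S :: (bounded_semilattice_sup_bot) "{zero, uminus}"
begin

definition zero_tensor_S :: "'a tensor_S" where "0 = signed 1 \<bottom>"
definition uminus_tensor_S :: "'a tensor_S \<Rightarrow> 'a tensor_S" where "- v = (-1) \<cdot> v"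

instance ..

end

text \<open>
  If the order on \<open>E\<close> is total, the three cases below are exhaustive; they overlap in
  \<open>0 \<smile> 0\<close> only through the same value \<open>{0}\<close>.
\<close>

definition smile ::
  "'a::bounded_semilattice_sup_bot tensor_S \<Rightarrow> 'a tensor_S \<Rightarrow> 'a tensor_S set"
  (infixl "\<smile>" 65) where
  "v \<smile> w = {z. (modulus v > modulus w \<or> v = w) \<and> z = v} \<union>
           {z. (modulus v < modulus w \<or> v = w) \<and> z = w} \<union>
           {z. w = - v \<and> modulus z \<le> modulus v}"

section \<open>Canonical hypergroups and modules over the signs\<close>

locale canonical_hypergroup =
  fixes add :: "'h \<Rightarrow> 'h \<Rightarrow> 'h set" (infixl "\<boxplus>" 65)
    and zero :: 'h
  assumes nonempty: "x \<boxplus> y \<noteq> {}"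
    and commute: "x \<boxplus> y = y \<boxplus> x"
    and assoc: "(\<Union>u \<in> x \<boxplus> y. u \<boxplus> z) = (\<Union>u \<in> y \<boxplus> z. x \<boxplus> u)"
    and zero_left: "zero \<boxplus> x = {x}"
    and zero_right: "x \<boxplus> zero = {x}"
    and ex1_neg: "\<exists>!y. zero \<in> x \<boxplus> y"
    and reversible: "x \<in> y \<boxplus> z \<Longrightarrow> z \<in> x \<boxplus> (THE w. zero \<in> y \<boxplus> w)"

definition S_hom ::
  "('a::bounded_semilattice_sup_bot tensor_S \<Rightarrow> 'b::bounded_semilattice_sup_bot tensor_S) \<Rightarrow> bool"
  where
  "S_hom g \<longleftrightarrow> (\<forall>l v. g (l \<cdot> v) = l \<cdot> g v) \<and> (\<forall>v w. g ` (v \<smile> w) \<subseteq> g v \<smile> g w)"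

definition S_automorphism ::
  "('a::bounded_semilattice_sup_bot tensor_S \<Rightarrow> 'a tensor_S) \<Rightarrow> bool" where
  "S_automorphism g \<longleftrightarrow>
     bij g \<and> (\<forall>l v. g (l \<cdot> v) = l \<cdot> g v) \<and> (\<forall>v w. g ` (v \<smile> w) = g v \<smile> g w)"

text \<open>
  The next two predicates are the formulas \<open>\<plusminus>x \<mapsto> \<plusminus>f(x)\<close> and \<open>\<plusminus>x \<mapsto> \<plusminus>\<epsilon>(x)x\<close>, \<open>0 \<mapsto> 0\<close>.  The maps they
  define are introduced by definite descriptions, which are meaningful only where the formula
  determines a unique map.
\<close>

definition tensor_map_formula ::
  "('a::bounded_semilattice_sup_bot \<Rightarrow> 'b::bounded_semilattice_sup_bot) \<Rightarrow>
   ('a tensor_S \<Rightarrow> 'b tensor_S) \<Rightarrow> bool" where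
  "tensor_map_formula f h \<longleftrightarrow> (\<forall>s\<in>{-1, 1}. \<forall>x. h (signed s x) = signed s (f x))"

definition tensor_map ::
  "('a::bounded_semilattice_sup_bot \<Rightarrow> 'b::bounded_semilattice_sup_bot) \<Rightarrow>
   'a tensor_S \<Rightarrow> 'b tensor_S" where
  "tensor_map f = (THE h. tensor_map_formula f h)"

definition sign_twist_formula ::
  "('a::bounded_semilattice_sup_bot \<Rightarrow> signs) \<Rightarrow> ('a tensor_S \<Rightarrow> 'a tensor_S) \<Rightarrow> bool" where
  "sign_twist_formula \<epsilon> h \<longleftrightarrow>
     h 0 = 0 \<and> (\<forall>s\<in>{-1, 1}. \<forall>x. x \<noteq> \<bottom> \<longrightarrow> h (signed s x) = signed (s * \<epsilon> x) x)"

definition sign_twist ::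
  "('a::bounded_semilattice_sup_bot \<Rightarrow> signs) \<Rightarrow> 'a tensor_S \<Rightarrow> 'a tensor_S" where
  "sign_twist \<epsilon> = (THE h. sign_twist_formula \<epsilon> h)"

end

theory Submission
  imports Defs
begin

text \<open>
  Two incomparable elements \<open>x\<close>, \<open>y\<close> of \<open>E\<close> would generate a copy \<open>{0, x, y, x \<squnion> y}\<close> of \<open>\<bool>\<^sup>2\<close>, so
  free rank one forces the order to be total.  Then \<open>v \<smile> w\<close> is always given by comparing moduli, and
  a morphism \<open>g\<close> has monotone modulus: if \<open>\<bar>v\<bar> < \<bar>w\<bar>\<close> then \<open>g w \<in> g v \<smile> g w\<close>, which is
  impossible for \<open>\<bar>g w\<bar> < \<bar>g v\<bar>\<close>.  Hence \<open>x \<mapsto> \<bar>g (+x)\<bar>\<close> is a morphism of \<open>\<bool>\<close>-semimodules,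
  and the signs of the \<open>g (+x)\<close> supply \<open>\<epsilon>\<close>.
\<close>

section \<open>Free rank one and total orders\<close>

lemma iso_B_power_2:
  fixes x y :: "'a::bounded_semilattice_sup_bot"
  assumes "\<not> x \<le> y" "\<not> y \<le> x"
  shows "iso_B_power 2 {\<bottom>, x, y, x \<squnion> y}"
  unfolding iso_B_power_def
proof (intro exI conjI ballI)
  \<comment> \<open>\<open>?\<phi>\<close> joins the generators selected by the coordinates 0 and 1;
    incomparability makes the four possible joins distinct, whence injectivity.\<close>
  let ?\<phi> = "\<lambda>v. (if v 0 then x else \<bottom>) \<squnion> (if v (1::nat) then y else \<bottom>)"
  have ne: "x \<noteq> \<bottom>" "y \<noteq> \<bottom>" "x \<noteq> y" "x \<squnion> y \<noteq> \<bottom>" "x \<squnion> y \<noteq> x" "x \<squnion> y \<noteq> y"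
    using assms by (auto simp: sup.order_iff sup_commute)
  show "?\<phi> \<bottom> = \<bottom>" by simp
  show "?\<phi> (u \<squnion> v) = ?\<phi> u \<squnion> ?\<phi> v" for u v
    by (auto simp: ac_simps)
  show "bij_betw ?\<phi> (B_power 2) {\<bottom>, x, y, x \<squnion> y}"
    unfolding bij_betw_def
  proof
    show "inj_on ?\<phi> (B_power 2)"
    proof (rule inj_onI)
      fix u v assume uv: "u \<in> B_power 2" "v \<in> B_power 2" "?\<phi> u = ?\<phi> v"
      have "u 0 = v 0" "u 1 = v 1"
        using uv(3) ne by (auto split: if_splits)
      moreover have "u i = v i" if "i \<ge> 2" for i
        using uv that by (auto simp: B_power_def)
      ultimately have "u i = v i" for i
        by (metis One_nat_def less_2_cases not_less)
      then show "u = v" ..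
    qed
    have "(if a then x else \<bottom>) \<squnion> (if b then y else \<bottom>) \<in> ?\<phi> ` B_power 2" for a b
      by (rule image_eqI[of _ _ "\<lambda>i. i = 0 \<and> a \<or> i = 1 \<and> b"]) (simp_all add: B_power_def)
    from this[of False False] this[of True False] this[of False True] this[of True True]
    have "{\<bottom>, x, y, x \<squnion> y} \<subseteq> ?\<phi> ` B_power 2"
      by (simp only: if_True if_False sup_bot_left sup_bot_right insert_subset empty_subsetI simp_thms)
    then show "?\<phi> ` B_power 2 = {\<bottom>, x, y, x \<squnion> y}"
      by (intro equalityI image_subsetI) simp_all
  qed
qed

lemma free_rank_1_total:
  fixes x y :: "'a::bounded_semilattice_sup_bot"
  assumes "free_rank TYPE('a) = 1"
  shows "x \<le> y \<or> y \<le> x"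
proof (rule ccontr)
  assume "\<not> ?thesis"
  then have "iso_B_power 2 {\<bottom>, x, y, x \<squnion> y}"
    by (simp add: iso_B_power_2)
  moreover have "subsemimodule {\<bottom>, x, y, x \<squnion> y}"
    by (auto simp: subsemimodule_def ac_simps)
  ultimately have "enat 2 \<le> free_rank TYPE('a)"
    unfolding free_rank_def by (intro SUP_upper) blast
  then show False
    by (simp add: assms one_enat_def)
qed

section \<open>Signed elements\<close>

text \<open>With the lifting setup of \<open>signs\<close> dropped, sign arithmetic is reduced to
  integers through the injective \<open>Rep_signs\<close>.\<close>

lemmas Rep_signs_simps = Rep_signs_inject[symmetric] zero_signs.rep_eq one_signs.rep_eq
  uminus_signs.rep_eq times_signs.rep_eq

lemma signs_ring:
  fixes s :: signs
  shows "0 * s = 0" "s * 0 = 0" "1 * s = s" "s * 1 = s" "-1 * s = - s" "s * -1 = - s"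
    "- (- s) = s" "- (0::signs) = 0"
    "- s = 0 \<longleftrightarrow> s = 0" "s \<noteq> 0 \<Longrightarrow> s * s = 1" "- s = s \<longleftrightarrow> s = 0"
  using Rep_signs[of s] by (auto simp: Rep_signs_simps)

lemma signs_mult_assoc: "s * t * r = s * (t * r :: signs)"
  by (simp add: Rep_signs_simps)

lemma signs_neg_one: "(-1::signs) \<noteq> 0" "(-1::signs) \<noteq> 1" "(0::signs) \<noteq> -1" "(1::signs) \<noteq> -1"
  by (simp_all add: Rep_signs_simps)

lemmas signs_simps = signs_ring signs_neg_one signs_one_neq_zero signs_mult_eq_zero_iff

lemma tensor_S_rel_iff:
  "tensor_S_rel p q \<longleftrightarrow>
     snd p \<noteq> 0 \<and> snd q \<noteq> 0 \<and> (p = q \<or> fst p = \<bottom> \<and> fst q = \<bottom>)"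
  unfolding tensor_S_rel_def mem_Times_iff signs_nonzero_iff by simp

lemma signed_cases:
  fixes v :: "'a::bounded_semilattice_sup_bot tensor_S"
  obtains s x where "v = signed s x" "s \<in> {-1, 1}"
proof -
  have "\<exists>s x. v = signed s x \<and> s \<noteq> 0"
    by transfer (auto simp: tensor_S_rel_iff)
  with that show thesis
    using signs_nonzero_iff by blast
qed

text \<open>The alternative \<open>x = \<bottom>\<close> is the identification of -0 with +0, the
  only one made by the quotient. Sign 0 is excluded because \<open>signed 0 x\<close> forgets
  \<open>x\<close>.\<close>

lemma signed_eq_iff:
  assumes "s \<noteq> 0" "t \<noteq> 0"
  shows "signed s x = signed t y \<longleftrightarrow> x = y \<and> (s = t \<or> x = \<bottom>)"
  using assms by transfer (auto simp: tensor_S_rel_iff)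

lemma modulus_signed: "modulus (signed s x) = (if s = 0 then \<bottom> else x)"
  by transfer simp

lemma act_signed: "l \<cdot> signed s x = signed (l * s) x"
  by transfer (auto simp: tensor_S_rel_iff signs_simps)

lemma signed_zero: "signed 0 x = 0"
  unfolding zero_tensor_S_def by transfer (simp add: tensor_S_rel_iff signs_simps)

lemma signed_bot: "signed s \<bottom> = 0"
  unfolding zero_tensor_S_def by transfer (simp add: tensor_S_rel_iff signs_simps)

lemma signed_eq_zero_iff: "signed s x = 0 \<longleftrightarrow> s = 0 \<or> x = \<bottom>"
  using signed_eq_iff[of s 1 x \<bottom>] signed_zero[of x]
  by (cases "s = 0") (auto simp: zero_tensor_S_def signs_simps)

lemma uminus_signed: "- signed s x = signed (- s) x"
  by (simp add: uminus_tensor_S_def act_signed signs_simps)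

lemma modulus_eq_bot_iff: "modulus v = \<bottom> \<longleftrightarrow> v = 0"
  by (cases v rule: signed_cases)
    (auto simp: modulus_signed signed_eq_zero_iff signs_simps)

lemma modulus_zero: "modulus 0 = \<bottom>"
  by (simp add: modulus_eq_bot_iff)

lemma modulus_uminus: "modulus (- v) = modulus v"
  by (cases v rule: signed_cases) (auto simp: modulus_signed uminus_signed signs_simps)

lemma tensor_uminus_uminus: "- (- v) = (v :: 'a::bounded_semilattice_sup_bot tensor_S)"
  by (cases v rule: signed_cases) (auto simp: uminus_signed signs_simps)

text \<open>Isolates the two cases in which \<open>\<smile>\<close> is not decided by the size of
  the moduli.\<close>

lemma modulus_eq_iff: "modulus v = modulus w \<longleftrightarrow> w = v \<or> w = - v"
  by (cases v rule: signed_cases; cases w rule: signed_cases)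
    (auto simp: modulus_signed uminus_signed signed_eq_iff signs_simps)

lemma tensor_uminus_zero: "- 0 = (0 :: 'a::bounded_semilattice_sup_bot tensor_S)"
  by (metis modulus_eq_bot_iff modulus_uminus)

lemma uminus_eq_self_iff: "- v = v \<longleftrightarrow> v = (0 :: 'a::bounded_semilattice_sup_bot tensor_S)"
  by (cases v rule: signed_cases)
    (auto simp: uminus_signed signed_eq_iff signed_eq_zero_iff signs_simps)

lemma act_simps: "0 \<cdot> v = 0" "1 \<cdot> v = v" "-1 \<cdot> v = - v"
  by (cases v rule: signed_cases;
      auto simp: act_signed signed_zero uminus_signed signs_simps)+

section \<open>The hypergroup\<close>

lemma mem_smile_iff:
  "z \<in> v \<smile> w \<longleftrightarrow>
     z = v \<and> (modulus w < modulus v \<or> v = w) \<or> z = w \<and> (modulus v < modulus w \<or> v = w) \<or>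
     w = - v \<and> modulus z \<le> modulus v"
  by (auto simp: smile_def)

text \<open>With the next three lemmas, this evaluates \<open>\<smile>\<close> in each case of the
  trichotomy below. The interval clause cannot interfere, since negation preserves the
  modulus.\<close>

lemma smile_less: "modulus v < modulus w \<Longrightarrow> v \<smile> w = {w}"
  by (auto simp: mem_smile_iff modulus_uminus)

lemma smile_greater: "modulus w < modulus v \<Longrightarrow> v \<smile> w = {v}"
  by (auto simp: mem_smile_iff modulus_uminus)

text \<open>The interval clause applies only if \<open>v = - v\<close>, hence \<open>v = 0\<close>,
  and then the interval is \<open>{0}\<close>.\<close>

lemma smile_self: "v \<smile> v = {v}"
  using uminus_eq_self_iff[of v]
  by (auto simp: mem_smile_iff modulus_zero bot_unique modulus_eq_bot_iff)

lemma smile_uminus: "v \<smile> - v = {z. modulus z \<le> modulus v}"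
  by (auto simp: mem_smile_iff modulus_uminus)

lemma smile_commute: "v \<smile> w = w \<smile> v"
  by (auto simp: mem_smile_iff modulus_uminus tensor_uminus_uminus)

section \<open>Hypergroup axioms over a totally ordered semimodule\<close>

context
  assumes total: "\<And>x y :: 'a::bounded_semilattice_sup_bot. x \<le> y \<or> y \<le> x"
begin

lemma modulus_trichotomy:
  fixes v w :: "'a tensor_S"
  obtains "modulus v < modulus w" | "modulus w < modulus v" | "w = v" | "w = - v"
  using total by (metis modulus_eq_iff order_le_less)

lemma modulus_smile_le:
  fixes v w z :: "'a tensor_S"
  assumes "z \<in> v \<smile> w" "modulus v \<le> m" "modulus w \<le> m"
  shows "modulus z \<le> m"
  using assms by (auto simp: mem_smile_iff)

text \<open>A strictly largest modulus wins under either bracketing; the delicate cases are those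
  where two opposite summands produce an interval. Comparing \<open>x\<close> with \<open>y\<close>,
  each case exhibits a suitable \<open>t\<close> in \<open>y \<smile> z\<close>.\<close>

lemma smile_assoc_subset:
  fixes x y z :: "'a tensor_S"
  shows "(\<Union>u \<in> x \<smile> y. u \<smile> z) \<subseteq> (\<Union>u \<in> y \<smile> z. x \<smile> u)"
proof
  fix w assume "w \<in> (\<Union>u \<in> x \<smile> y. u \<smile> z)"
  then obtain u where u: "u \<in> x \<smile> y" and w: "w \<in> u \<smile> z" by blast
  have "\<exists>t. t \<in> y \<smile> z \<and> w \<in> x \<smile> t"
  proof (cases rule: modulus_trichotomy[of x y])
    case 1
    then have wyz: "w \<in> y \<smile> z"
      using u w by (simp add: smile_less)
    \<comment> \<open>The choice \<open>t = w\<close> works as long as \<open>w\<close> dominates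
      \<open>x\<close>.\<close>
    show ?thesis
    proof (cases "modulus x < modulus w")
      case True
      with wyz show ?thesis by (auto simp: smile_less)
    next
      case False
      then have le: "modulus w \<le> modulus x"
        using total[of "modulus w" "modulus x"] by (auto simp: less_le)
      \<comment> \<open>An element of \<open>y \<smile> z\<close> smaller than \<open>y\<close> can
        only come from cancellation, \<open>z = - y\<close>. The resulting interval contains
        \<open>- x\<close>, so \<open>t = - x\<close> works.\<close>
      have "\<not> modulus y \<le> modulus w"
        using le 1 by (meson leD order_trans)
      then have "z = - y"
        using wyz by (auto simp: mem_smile_iff)
      then have "- x \<in> y \<smile> z"
        using 1 by (simp add: smile_uminus modulus_uminus less_imp_le)
      moreover have "w \<in> x \<smile> - x"
        using le by (simp add: smile_uminus)
      ultimately show ?thesis by blast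
    qed
  next
    case 2
    then have wxz: "w \<in> x \<smile> z"
      using u w by (simp add: smile_greater)
    show ?thesis
    proof (cases "modulus y < modulus z")
      case True
      with wxz show ?thesis by (auto simp: smile_less)
    next
      case False
      then have le: "modulus z \<le> modulus y"
        using total[of "modulus z" "modulus y"] by (auto simp: less_le)
      \<comment> \<open>Either \<open>z\<close> is strictly smaller than \<open>y\<close>, or
        \<open>z\<close> is \<open>y\<close> or \<open>- y\<close>; \<open>y\<close> survives in all
        three cases, and \<open>t = y\<close>.\<close>
      then have "y \<in> y \<smile> z"
        by (auto simp: mem_smile_iff less_le modulus_eq_iff tensor_uminus_uminus)
      moreover have "w = x"
        using wxz le 2 by (simp add: smile_greater order.strict_trans1)
      ultimately show ?thesis
        using 2 by (auto simp: smile_greater)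
    qed
  next
    case 3
    then have "w \<in> x \<smile> z"
      using u w by (simp add: smile_self)
    \<comment> \<open>The only case needing a chosen witness is \<open>z = - x\<close>: both sums
      are then intervals, and \<open>t = - x\<close> reaches every \<open>w\<close> in
      \<open>x \<smile> - x\<close>.\<close>
    then show ?thesis
      using 3
      by (cases rule: modulus_trichotomy[of x z])
        (auto simp: smile_less smile_greater smile_self smile_uminus modulus_uminus
          intro: exI[of _ "- x"])
  next
    case 4
    then have ux: "modulus u \<le> modulus x"
      using u by (simp add: smile_uminus)
    show ?thesis
    proof (cases "modulus x < modulus z")
      case True
      then have "modulus u < modulus z"
        using ux by simp
      with True 4 w show ?thesis
        by (auto simp: smile_less modulus_uminus)
    next
      case False
      then have le: "modulus z \<le> modulus x"
        using total[of "modulus z" "modulus x"] by (auto simp: less_le)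
      then have "y \<in> y \<smile> z"
        using 4 by (auto simp: mem_smile_iff less_le modulus_eq_iff modulus_uminus
            tensor_uminus_uminus)
      \<comment> \<open>Neither \<open>u\<close> nor \<open>z\<close> exceeds \<open>x\<close> in
        modulus, so their sum stays in the interval \<open>x \<smile> - x\<close>; again
        \<open>t = y\<close>.\<close>
      moreover have "w \<in> x \<smile> y"
        using modulus_smile_le[OF w ux le] 4 by (simp add: smile_uminus)
      ultimately show ?thesis by blast
    qed
  qed
  then show "w \<in> (\<Union>u \<in> y \<smile> z. x \<smile> u)" by blast
qed

text \<open>Exchanging \<open>x\<close> and \<open>z\<close> turns the inclusion already proved into
  the converse one, by commutativity.\<close>

lemma smile_assoc:
  fixes x y z :: "'a tensor_S"
  shows "(\<Union>u \<in> x \<smile> y. u \<smile> z) = (\<Union>u \<in> y \<smile> z. x \<smile> u)"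
proof (rule equalityI[OF smile_assoc_subset])
  have "(\<Union>u \<in> z \<smile> y. u \<smile> x) = (\<Union>u \<in> y \<smile> z. x \<smile> u)"
    "(\<Union>u \<in> y \<smile> x. z \<smile> u) = (\<Union>u \<in> x \<smile> y. u \<smile> z)"
    by (intro SUP_cong smile_commute)+
  with smile_assoc_subset[where x = z and y = y and z = x]
  show "(\<Union>u \<in> y \<smile> z. x \<smile> u) \<subseteq> (\<Union>u \<in> x \<smile> y. u \<smile> z)"
    by simp
qed

lemma zero_smile: "0 \<smile> v = {v :: 'a tensor_S}"
proof (cases "v = 0")
  case False
  then have "modulus 0 < modulus v"
    by (simp add: modulus_zero modulus_eq_bot_iff flip: bot.not_eq_extremum)
  then show ?thesis by (rule smile_less)
qed (simp add: smile_self)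

text \<open>Gives the unique negative and evaluates the description \<open>THE w\<close> in the
  reversibility axiom to \<open>- y\<close>.\<close>

lemma zero_mem_smile_iff: "0 \<in> v \<smile> w \<longleftrightarrow> w = - (v :: 'a tensor_S)"
  by (auto simp: mem_smile_iff modulus_zero tensor_uminus_zero)

lemma smile_nonempty: "v \<smile> w \<noteq> ({} :: 'a tensor_S set)"
  by (cases rule: modulus_trichotomy[of v w])
    (auto simp: smile_less smile_greater smile_self smile_uminus)

text \<open>If \<open>y\<close> is strictly smaller than \<open>z\<close>, then \<open>x = z\<close>
  dominates \<open>- y\<close>. If \<open>z\<close> is smaller than \<open>y\<close> or equal to it,
  then \<open>x = y\<close> and \<open>x \<smile> - y\<close> is an interval containing
  \<open>z\<close>. If \<open>z = - y\<close>, then \<open>x\<close> is no larger than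
  \<open>- y\<close>, so \<open>- y\<close> survives in the sum.\<close>

lemma smile_reversible:
  fixes x y z :: "'a tensor_S"
  assumes "x \<in> y \<smile> z"
  shows "z \<in> x \<smile> - y"
  using assms
  by (cases rule: modulus_trichotomy[of y z])
    (auto simp: smile_less smile_greater smile_self smile_uminus modulus_uminus
      mem_smile_iff less_le modulus_eq_iff tensor_uminus_uminus)

theorem canonical_hypergroup_smile:
  "canonical_hypergroup ((\<smile>) :: 'a tensor_S \<Rightarrow> 'a tensor_S \<Rightarrow> 'a tensor_S set) 0"
proof
  show "x \<smile> 0 = {x}" for x :: "'a tensor_S"
    using zero_smile smile_commute by metis
  show "x \<smile> y = y \<smile> x" for x y :: "'a tensor_S"
    by (rule smile_commute)
qed (simp_all add: smile_nonempty zero_smile smile_assoc zero_mem_smile_iff smile_reversible)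

section \<open>Module structure over the signs\<close>

lemma act_smile:
  fixes v w :: "'a tensor_S"
  shows "(\<lambda>u. l \<cdot> u) ` (v \<smile> w) = l \<cdot> v \<smile> l \<cdot> w"
proof -
  have neg: "uminus ` (v \<smile> w) \<subseteq> - v \<smile> - w" for v w :: "'a tensor_S"
    by (auto simp: mem_smile_iff modulus_uminus)
  \<comment> \<open>Negation is an involution, so the inclusion at \<open>- v\<close> and
    \<open>- w\<close> yields its own converse.\<close>
  have "- v \<smile> - w \<subseteq> uminus ` (v \<smile> w)"
  proof
    fix z assume "z \<in> - v \<smile> - w"
    then have "- z \<in> v \<smile> w"
      using neg[of "- v" "- w"] by (auto simp: tensor_uminus_uminus)
    then show "z \<in> uminus ` (v \<smile> w)"
      by (metis imageI tensor_uminus_uminus)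
  qed
  with neg have "uminus ` (v \<smile> w) = - v \<smile> - w" by blast
  \<comment> \<open>For \<open>l = 0\<close> the image is \<open>{0}\<close> only because
    \<open>v \<smile> w\<close> is nonempty.\<close>
  then show ?thesis
    using signs_cases[of l] smile_nonempty[of v w]
    by (auto simp: act_simps zero_smile)
qed

text \<open>For opposite nonzero signs the left side is \<open>{- v, 0, v}\<close>, while the right
  side is the whole interval below \<open>v\<close>, which may also contain intermediate moduli;
  hence only an inclusion.\<close>

lemma signs_hyperadd_act:
  fixes v :: "'a tensor_S"
  shows "(\<lambda>m. m \<cdot> v) ` signs_hyperadd l l' \<subseteq> l \<cdot> v \<smile> l' \<cdot> v"
  using signs_cases[of l] signs_cases[of l'] zero_smile[of "- v"] zero_smile[of v]
  by (auto simp: signs_hyperadd_def act_simps signs_simps smile_self smile_uminus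
      smile_commute[of v 0] smile_commute[of "- v" 0] smile_commute[of "- v" v]
      modulus_uminus modulus_zero)

end

section \<open>The maps induced by a morphism and by a choice of signs\<close>

lemma tensor_S_map_eqI:
  assumes "\<And>s x. s \<in> {-1, 1} \<Longrightarrow> g (signed s x) = h (signed s x)"
  shows "g = h"
  using assms signed_cases by (metis ext)

text \<open>Only 0 has two presentations with signs 1 and -1, and
  \<open>f \<bottom> = \<bottom>\<close> makes both prescribed values 0. The choice
  \<open>SOME\<close> below is thus among equal values.\<close>

lemma tensor_map_formula_ex1:
  assumes "f \<bottom> = \<bottom>"
  shows "\<exists>!h. tensor_map_formula f h"
proof (rule ex_ex1I)
  define h where "h v = (SOME w. \<exists>s\<in>{-1, 1}. \<exists>x. v = signed s x \<and> w = signed s (f x))" for v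
  have "h (signed s x) = signed s (f x)" if "s \<in> {-1, 1}" for s x
    unfolding h_def
    by (rule some_equality) (use that assms in \<open>auto simp: signed_eq_iff signs_simps signed_bot\<close>)
  then show "\<exists>h. tensor_map_formula f h"
    unfolding tensor_map_formula_def by blast
  show "h = h'" if "tensor_map_formula f h" "tensor_map_formula f h'" for h h'
    using that by (intro tensor_S_map_eqI) (auto simp: tensor_map_formula_def)
qed

lemma tensor_map_signed:
  assumes "f \<bottom> = \<bottom>"
  shows "tensor_map f (signed s x) = signed s (f x)"
proof -
  have F: "tensor_map_formula f (tensor_map f)"
    unfolding tensor_map_def by (rule theI'[OF tensor_map_formula_ex1[where f = f, OF assms]])
  \<comment> \<open>The formula concerns nonzero signs only; its instance at +0 also covers
    \<open>s = 0\<close>, where \<open>signed\<close> is 0 by convention.\<close>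
  then have "tensor_map f (signed 1 \<bottom>) = signed 1 (f \<bottom>)"
    unfolding tensor_map_formula_def by blast
  then show ?thesis
    using F signs_cases[of s] assms
    by (auto simp: tensor_map_formula_def signed_zero signed_bot)
qed

lemma modulus_tensor_map:
  assumes "f \<bottom> = \<bottom>"
  shows "modulus (tensor_map f v) = f (modulus v)"
  by (cases v rule: signed_cases) (auto simp: tensor_map_signed assms modulus_signed)

lemma tensor_map_act:
  assumes "f \<bottom> = \<bottom>"
  shows "tensor_map f (l \<cdot> v) = l \<cdot> tensor_map f v"
  by (cases v rule: signed_cases) (auto simp: tensor_map_signed assms act_signed)

lemma tensor_map_uminus:
  assumes "f \<bottom> = \<bottom>"
  shows "tensor_map f (- v) = - tensor_map f v"
  by (simp add: tensor_map_act assms uminus_tensor_S_def)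

lemma B_hom_bot: "B_hom f \<Longrightarrow> f \<bottom> = \<bottom>"
  by (simp add: B_hom_def)

lemma B_hom_mono: "B_hom f \<Longrightarrow> x \<le> y \<Longrightarrow> f x \<le> f y"
  unfolding B_hom_def by (metis sup.absorb_iff2)

lemma S_hom_tensor_map:
  assumes f: "B_hom (f :: 'a::bounded_semilattice_sup_bot \<Rightarrow> 'b::bounded_semilattice_sup_bot)"
  shows "S_hom (tensor_map f)"
proof -
  have bot: "f \<bottom> = \<bottom>"
    using f by (rule B_hom_bot)
  note maps = modulus_tensor_map[where f = f, OF bot] tensor_map_uminus[where f = f, OF bot]
  \<comment> \<open>A morphism may identify moduli that were strictly ordered. The images are then
    equal or opposite, and their sum still contains the image of \<open>w\<close>.\<close>
  have mem: "tensor_map f w \<in> tensor_map f v \<smile> tensor_map f w" if "modulus v < modulus w" for v w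
  proof (cases "modulus (tensor_map f v) = modulus (tensor_map f w)")
    case True
    then show ?thesis
      by (auto simp: modulus_eq_iff smile_self smile_uminus modulus_uminus)
  next
    case False
    then have "modulus (tensor_map f v) < modulus (tensor_map f w)"
      using that B_hom_mono[OF f, of "modulus v" "modulus w"] by (simp add: maps less_le)
    then show ?thesis by (simp add: smile_less)
  qed
  have "tensor_map f z \<in> tensor_map f v \<smile> tensor_map f w" if "z \<in> v \<smile> w" for v w z
    using that mem[of v w] mem[of w v] B_hom_mono[OF f, of "modulus z" "modulus v"]
    by (auto simp: mem_smile_iff[of z] smile_self smile_uminus maps
        smile_commute[of "tensor_map f w"])
  then show ?thesis
    by (auto simp: S_hom_def tensor_map_act[where f = f, OF bot])
qed

section \<open>Twisting by a choice of signs\<close>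

lemma sign_twist_formula_ex1:
  "\<exists>!h. sign_twist_formula \<epsilon> h"
proof (rule ex_ex1I)
  \<comment> \<open>The value at 0 is set separately; a nonzero element has exactly one
    presentation, so the choice is forced.\<close>
  define h where "h v = (if v = 0 then 0 else
      SOME w. \<exists>s\<in>{-1, 1}. \<exists>x. v = signed s x \<and> w = signed (s * \<epsilon> x) x)" for v
  have "h (signed s x) = signed (s * \<epsilon> x) x" if "s \<in> {-1, 1}" "x \<noteq> \<bottom>" for s x
  proof -
    have "signed s x \<noteq> 0"
      using that by (auto simp: signed_eq_zero_iff signs_simps)
    moreover have "(SOME w. \<exists>t\<in>{-1, 1}. \<exists>y. signed s x = signed t y \<and> w = signed (t * \<epsilon> y) y)
        = signed (s * \<epsilon> x) x"
      by (rule some_equality) (use that in \<open>auto simp: signed_eq_iff signs_simps\<close>)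
    ultimately show ?thesis by (simp add: h_def)
  qed
  moreover have "h 0 = 0" by (simp add: h_def)
  ultimately show "\<exists>h. sign_twist_formula \<epsilon> h"
    unfolding sign_twist_formula_def by blast
  show "h = h'" if "sign_twist_formula \<epsilon> h" "sign_twist_formula \<epsilon> h'" for h h'
  proof (rule tensor_S_map_eqI)
    show "h (signed s x) = h' (signed s x)" if "s \<in> {-1, 1}" for s x
      using that \<open>sign_twist_formula \<epsilon> h\<close> \<open>sign_twist_formula \<epsilon> h'\<close>
      by (cases "x = \<bottom>") (auto simp: sign_twist_formula_def signed_bot)
  qed
qed

text \<open>The equation also holds at \<open>\<bottom>\<close>, whatever value
  \<open>\<epsilon>\<close> takes there, because both sides are 0.\<close>

lemma sign_twist_signed: "sign_twist \<epsilon> (signed s x) = signed (s * \<epsilon> x) x"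
proof -
  have "sign_twist_formula \<epsilon> (sign_twist \<epsilon>)"
    unfolding sign_twist_def by (rule theI'[OF sign_twist_formula_ex1])
  then show ?thesis
    using signs_cases[of s]
    by (cases "x = \<bottom>") (auto simp: sign_twist_formula_def signed_bot signed_zero signs_simps)
qed

lemma sign_twist_zero: "sign_twist \<epsilon> 0 = 0"
  using sign_twist_signed[of \<epsilon> 0 \<bottom>] by (simp add: signed_bot)

lemma sign_twist_act: "sign_twist \<epsilon> (l \<cdot> v) = l \<cdot> sign_twist \<epsilon> v"
  by (cases v rule: signed_cases) (simp add: sign_twist_signed act_signed signs_mult_assoc)

context
  fixes \<epsilon> :: "'a::bounded_semilattice_sup_bot \<Rightarrow> signs"
  assumes \<epsilon>: "\<epsilon> \<in> (UNIV - {\<bottom>}) \<rightarrow>\<^sub>E {-1, 1}"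
begin

lemma sign_ne_zero: "x \<noteq> \<bottom> \<Longrightarrow> \<epsilon> x \<noteq> 0"
  using PiE_mem[OF \<epsilon>, of x] by (auto simp: signs_simps)

lemma modulus_sign_twist: "modulus (sign_twist \<epsilon> v) = modulus v"
proof (cases v rule: signed_cases)
  case (1 s x)
  then show ?thesis
    using sign_ne_zero[of x] by (auto simp: sign_twist_signed modulus_signed signs_simps)
qed

text \<open>Two twists multiply the sign by the square of \<open>\<epsilon> x\<close>, which is 1.
  Being its own inverse makes the twist bijective and upgrades the inclusion of sums to
  equality.\<close>

lemma sign_twist_involutive: "sign_twist \<epsilon> (sign_twist \<epsilon> v) = v"
proof (cases v rule: signed_cases)
  case (1 s x)
  then show ?thesis
    using sign_ne_zero[of x]
    by (cases "x = \<bottom>")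
      (auto simp: sign_twist_signed sign_twist_zero signed_bot signs_simps signs_mult_assoc)
qed

lemma S_automorphism_sign_twist: "S_automorphism (sign_twist \<epsilon>)"
  unfolding S_automorphism_def
proof (intro conjI allI)
  let ?t = "sign_twist \<epsilon>"
  show "bij ?t"
    by (rule o_bij[of ?t]) (auto simp: sign_twist_involutive)
  show "?t (l \<cdot> v) = l \<cdot> ?t v" for l v
    by (rule sign_twist_act)
  \<comment> \<open>Membership in \<open>\<smile>\<close> involves only moduli, equality and
    negation, all of which the twist respects.\<close>
  have sub: "?t ` (v \<smile> w) \<subseteq> ?t v \<smile> ?t w" for v w
    by (auto simp: mem_smile_iff modulus_sign_twist sign_twist_act uminus_tensor_S_def)
  show "?t ` (v \<smile> w) = ?t v \<smile> ?t w" for v w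
  proof
    have "?t ` (?t v \<smile> ?t w) \<subseteq> v \<smile> w"
      using sub[of "?t v" "?t w"] by (simp add: sign_twist_involutive)
    then have "?t ` ?t ` (?t v \<smile> ?t w) \<subseteq> ?t ` (v \<smile> w)"
      by (rule image_mono)
    then show "?t v \<smile> ?t w \<subseteq> ?t ` (v \<smile> w)"
      by (simp add: image_image sign_twist_involutive)
  qed (rule sub)
qed

end

section \<open>Factorization of morphisms with trivial kernel\<close>

lemma S_hom_factorization:
  fixes g :: "'a::bounded_semilattice_sup_bot tensor_S \<Rightarrow> 'b::bounded_semilattice_sup_bot tensor_S"
  assumes total: "\<And>x y :: 'a. x \<le> y \<or> y \<le> x"
    and total': "\<And>x y :: 'b. x \<le> y \<or> y \<le> x"
    and g: "S_hom g" and ker: "g -` {0} = {0}"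
  shows "\<exists>!(f, \<epsilon>). B_hom f \<and> \<epsilon> \<in> (UNIV - {\<bottom>}) \<rightarrow>\<^sub>E {-1, 1} \<and>
           g = tensor_map f \<circ> sign_twist \<epsilon>"
proof -
  have act: "g (l \<cdot> v) = l \<cdot> g v" and smile: "z \<in> v \<smile> w \<Longrightarrow> g z \<in> g v \<smile> g w" for l v w z
    using g unfolding S_hom_def by blast+
  have zero_iff: "g v = 0 \<longleftrightarrow> v = 0" for v
    using ker by auto
  have mono: "modulus (g v) \<le> modulus (g w)" if "modulus v < modulus w" for v w
  proof (rule ccontr)
    assume "\<not> ?thesis"
    then have "modulus (g w) < modulus (g v)"
      using total' by (auto simp: less_le)
    moreover have "g w \<in> g v \<smile> g w"
      using that by (intro smile) (simp add: smile_less)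
    ultimately show False
      by (auto simp: smile_greater)
  qed
  define f where "f x = modulus (g (signed 1 x))" for x
  have bot: "f \<bottom> = \<bottom>"
    by (simp add: f_def signed_bot modulus_eq_bot_iff zero_iff)
  have f_mono: "f x \<le> f y" if "x \<le> y" for x y
    using that mono[of "signed 1 x" "signed 1 y"]
    by (cases "x = y") (auto simp: f_def modulus_signed signs_simps less_le)
  \<comment> \<open>In a total order the join is the larger element, so monotonicity
    suffices.\<close>
  have f_sup: "f (x \<squnion> y) = f x \<squnion> f y" for x y
    using total[of x y] f_mono[of x y] f_mono[of y x] by (auto simp: sup_absorb1 sup_absorb2)
  \<comment> \<open>The trivial kernel keeps \<open>f x\<close> nonzero, so that the sign of
    \<open>g (signed 1 x)\<close> is well determined; uniqueness of \<open>\<epsilon>\<close> rests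
    on this.\<close>
  have f_ne_bot: "f x \<noteq> \<bottom>" if "x \<noteq> \<bottom>" for x
    using that by (auto simp: f_def modulus_eq_bot_iff zero_iff signed_eq_zero_iff signs_simps)
  have "\<exists>s. s \<in> {-1, 1} \<and> g (signed 1 x) = signed s (f x)" for x
    by (cases "g (signed 1 x)" rule: signed_cases) (auto simp: f_def modulus_signed signs_simps)
  then obtain e where e: "e x \<in> {-1, 1}" "g (signed 1 x) = signed (e x) (f x)" for x
    by metis
  \<comment> \<open>Maps on the nonzero elements are encoded extensionally by
    \<open>\<rightarrow>\<^sub>E\<close>: \<open>restrict\<close> makes the value at
    \<open>\<bottom>\<close> \<open>undefined\<close>, without which \<open>\<epsilon>\<close> would
    not be unique.\<close>
  define \<epsilon> where "\<epsilon> = restrict e (UNIV - {\<bottom>})"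
  have \<epsilon>: "\<epsilon> \<in> (UNIV - {\<bottom>}) \<rightarrow>\<^sub>E {-1, 1}"
    using e(1) by (auto simp: \<epsilon>_def)
  have g_signed: "g (signed s x) = signed (s * \<epsilon> x) (f x)" for s x
  proof -
    have "g (signed s x) = s \<cdot> g (signed 1 x)"
      by (simp add: act_signed signs_simps flip: act)
    then show ?thesis
      by (cases "x = \<bottom>") (auto simp: e(2) act_signed \<epsilon>_def bot signed_bot zero_iff)
  qed
  show ?thesis
  proof (rule ex1I[of _ "(f, \<epsilon>)"])
    have "g = tensor_map f \<circ> sign_twist \<epsilon>"
      by (rule tensor_S_map_eqI) (simp add: g_signed sign_twist_signed tensor_map_signed bot)
    then show "case (f, \<epsilon>) of (f, \<epsilon>) \<Rightarrow> B_hom f \<and> \<epsilon> \<in> (UNIV - {\<bottom>}) \<rightarrow>\<^sub>E {-1, 1} \<and>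
        g = tensor_map f \<circ> sign_twist \<epsilon>"
      using \<epsilon> by (simp add: B_hom_def bot f_sup)
  next
    fix p :: "('a \<Rightarrow> 'b) \<times> ('a \<Rightarrow> signs)"
    assume p: "case p of (f, \<epsilon>) \<Rightarrow> B_hom f \<and> \<epsilon> \<in> (UNIV - {\<bottom>}) \<rightarrow>\<^sub>E {-1, 1} \<and>
        g = tensor_map f \<circ> sign_twist \<epsilon>"
    obtain f' \<epsilon>' where p_eq: "p = (f', \<epsilon>')" by (cases p)
    have f': "f' \<bottom> = \<bottom>" and \<epsilon>': "\<epsilon>' \<in> (UNIV - {\<bottom>}) \<rightarrow>\<^sub>E {-1, 1}"
      and g': "g = tensor_map f' \<circ> sign_twist \<epsilon>'"
      using p by (auto simp: p_eq B_hom_def)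
    \<comment> \<open>Taking moduli removes the twist, so any factorization has \<open>f' x\<close>
      equal to the modulus of \<open>g (signed 1 x)\<close>.\<close>
    have "f' x = f x" for x
      by (simp add: f_def g' modulus_tensor_map[of f', OF f'] modulus_sign_twist[OF \<epsilon>']
          modulus_signed signs_simps)
    then have "f' = f" ..
    moreover have "\<epsilon>' = \<epsilon>"
    proof (rule PiE_ext[OF \<epsilon>' \<epsilon>])
      fix x :: 'a assume "x \<in> UNIV - {\<bottom>}"
      then have "x \<noteq> \<bottom>" by simp
      \<comment> \<open>Both sides are \<open>g (signed 1 x)\<close>; as \<open>f x\<close> is
        nonzero, the signs can be compared.\<close>
      have "signed (\<epsilon>' x) (f x) = signed (\<epsilon> x) (f x)"
        using g_signed[of 1 x]
        by (simp add: g' \<open>f' = f\<close> tensor_map_signed bot sign_twist_signed signs_simps)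
      then show "\<epsilon>' x = \<epsilon> x"
        using f_ne_bot sign_ne_zero[OF \<epsilon>] sign_ne_zero[OF \<epsilon>'] \<open>x \<noteq> \<bottom>\<close>
        by (simp add: signed_eq_iff)
    qed
    ultimately show "p = (f, \<epsilon>)" by (simp add: p_eq)
  qed
qed

theorem lemma5p1:
  assumes "free_rank TYPE('a::bounded_semilattice_sup_bot) = 1"
    and "free_rank TYPE('b::bounded_semilattice_sup_bot) = 1"
  shows
    "(canonical_hypergroup ((\<smile>) :: 'a tensor_S \<Rightarrow> 'a tensor_S \<Rightarrow> 'a tensor_S set) 0 \<and>
      (\<forall>l. \<forall>v v' :: 'a tensor_S. (\<lambda>u. l \<cdot> u) ` (v \<smile> v') = l \<cdot> v \<smile> l \<cdot> v') \<and>
      (\<forall>l l'. \<forall>v :: 'a tensor_S. (\<lambda>m. m \<cdot> v) ` signs_hyperadd l l' \<subseteq> l \<cdot> v \<smile> l' \<cdot> v)) \<and>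
     (\<forall>f :: 'a \<Rightarrow> 'b. B_hom f \<longrightarrow>
        (\<exists>!h. tensor_map_formula f h) \<and> S_hom (tensor_map f)) \<and>
     (\<forall>\<epsilon> \<in> (UNIV - {\<bottom> :: 'a}) \<rightarrow>\<^sub>E {-1, 1}.
        (\<exists>!h. sign_twist_formula \<epsilon> h) \<and> S_automorphism (sign_twist \<epsilon>)) \<and>
     (\<forall>g :: 'a tensor_S \<Rightarrow> 'b tensor_S. S_hom g \<and> g -` {0} = {0} \<longrightarrow>
        (\<exists>!(f, \<epsilon>). B_hom f \<and> \<epsilon> \<in> (UNIV - {\<bottom>}) \<rightarrow>\<^sub>E {-1, 1} \<and>
           g = tensor_map f \<circ> sign_twist \<epsilon>))"
proof -
  note total = free_rank_1_total[OF assms(1)] and total' = free_rank_1_total[OF assms(2)]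
  show ?thesis
    by (intro conjI allI ballI impI)
      (simp_all add: canonical_hypergroup_smile[OF total] act_smile[OF total]
        signs_hyperadd_act[OF total] tensor_map_formula_ex1 S_hom_tensor_map B_hom_bot
        sign_twist_formula_ex1 S_automorphism_sign_twist S_hom_factorization[OF total total'])
qed

end
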